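(* Let $A\in\mathbb{C}^{n\times n}$ be normal with orthonormal eigendecomposition $A=\sum_{j=1}^n\lambda_j\boldsymbol{u}_j\boldsymbol{u}_j^*$, where $\boldsymbol{u}_1,\dots,\boldsymbol{u}_n$ is an orthonormal basis of $\mathbb{C}^n$ and $\lambda_1,\dots,\lambda_n\in\mathbb{C}$, and let $\boldsymbol{B}\in\mathbb{C}^{n\times s}$. Then, for all $s\times s$ matrix polynomials $P(z)$ and $Q(z)$, $$\langle\!\langle P,Q\rangle\!\rangle_{A,\boldsymbol{B}}=\sum_{j=1}^n P(\lambda_j)^*\,(\boldsymbol{u}_j^*\boldsymbol{B})^*(\boldsymbol{u}_j^*\boldsymbol{B})\,Q(\lambda_j).$$
   Context: A matrix polynomial is $P(z)=\sum_{k=0}^{d}z^kC_k$ with $C_k\in\mathbb{C}^{s\times s}$; its action on $\boldsymbol{B}$ through $A$ is $P(A)\circ\boldsymbol{B}=\sum_{k=0}^{d}A^k\boldsymbol{B}C_k\in\mathbb{C}^{n\times s}$. The inner product induced by $(A,\boldsymbol{B})$ is $\langle\!\langle P,Q\rangle\!\rangle_{A,\boldsymbol{B}}=(P(A)\circ\boldsymbol{B})^*\,(Q(A)\circ\boldsymbol{B})\in\mathbb{C}^{s\times s}$. *)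

theory Defs
  imports "HOL-Analysis.Analysis" "HOL-Computational_Algebra.Polynomial"
begin

text \<open>An \<open>m \<times> n\<close> complex matrix has type \<^typ>\<open>complex^'n^'m\<close>, with product \<open>**\<close>.
  The operations \<open>*\<close> and \<open>^\<close> on this type are entrywise and are never used here.\<close>

definition mat_ctranspose :: "complex^'n^'m \<Rightarrow> complex^'m^'n" where
  "mat_ctranspose M = (\<chi> i j. cnj (M $ j $ i))"

definition mat_scale :: "complex \<Rightarrow> complex^'n^'m \<Rightarrow> complex^'n^'m" where
  "mat_scale c M = map_matrix ((*) c) M"

primrec mat_power :: "complex^'n^'n \<Rightarrow> nat \<Rightarrow> complex^'n^'n" where
  "mat_power A 0 = mat 1"
| "mat_power A (Suc k) = A ** mat_power A k"

definition normal_matrix :: "complex^'n^'n \<Rightarrow> bool" where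
  "normal_matrix A \<longleftrightarrow> A ** mat_ctranspose A = mat_ctranspose A ** A"

abbreviation column_mat :: "complex^'n \<Rightarrow> complex^1^'n" where
  "column_mat v \<equiv> columnvector v"

text \<open>The library's \<open>\<bullet>\<close> on \<^typ>\<open>complex^'n\<close> is only the real inner product, so the
  Hermitian one, \<open>u\<^sub>i\<^sup>* u\<^sub>j\<close>, is written out.\<close>

definition orthonormal_basis :: "('n::finite \<Rightarrow> complex^'n) \<Rightarrow> bool" where
  "orthonormal_basis u \<longleftrightarrow>
     (\<forall>i j. (\<Sum>k\<in>UNIV. cnj (u i $ k) * u j $ k) = (if i = j then 1 else 0)) \<and>
     vec.span (range u) = UNIV"

text \<open>A matrix polynomial is an element of \<^typ>\<open>(complex^'s^'s) poly\<close>. This type serves only as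
  the type of finitely supported coefficient sequences: the library's \<open>poly\<close> and the
  multiplication of polynomials would use the entrywise product of matrices.\<close>

type_synonym 's matpoly = "(complex^'s^'s) poly"

definition matpoly_eval :: "'s::finite matpoly \<Rightarrow> complex \<Rightarrow> complex^'s^'s" where
  "matpoly_eval P z = (\<Sum>k\<le>degree P. mat_scale (z ^ k) (coeff P k))"

definition matpoly_action ::
    "'s::finite matpoly \<Rightarrow> complex^'n^'n \<Rightarrow> complex^'s^'n \<Rightarrow> complex^'s^'n" where
  "matpoly_action P A B = (\<Sum>k\<le>degree P. mat_power A k ** B ** coeff P k)"

definition matpoly_inner ::
    "complex^'n^'n \<Rightarrow> complex^'s^'n \<Rightarrow> 's::finite matpoly \<Rightarrow> 's matpoly \<Rightarrow> complex^'s^'s" where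
  "matpoly_inner A B P Q = mat_ctranspose (matpoly_action P A B) ** matpoly_action Q A B"

end

theory Submission
  imports Defs
begin

text \<open>Orthonormality gives \<open>u\<^sub>j\<^sup>* A = \<lambda>\<^sub>j u\<^sub>j\<^sup>*\<close>, hence \<open>u\<^sub>j\<^sup>* (P(A) \<circ> B) = u\<^sub>j\<^sup>* B P(\<lambda>\<^sub>j)\<close>. Inserting the
  resolution of the identity \<open>I = \<Sum>\<^sub>j u\<^sub>j u\<^sub>j\<^sup>*\<close> between the two factors of the inner product yields the
  claim.\<close>

lemma matrix_mult_sum_right:
  fixes M :: "'a::semiring_1^'n::finite^'m" and F :: "'i \<Rightarrow> 'a^'p^'n"
  shows "M ** (\<Sum>x\<in>S. F x) = (\<Sum>x\<in>S. M ** F x)"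
proof (induction S rule: infinite_finite_induct)
  case (insert x S)
  then show ?case
    by (simp add: matrix_add_ldistrib)
qed (auto simp: matrix_matrix_mult_def vec_eq_iff)

lemma matrix_mult_sum_left:
  fixes M :: "'a::semiring_1^'p^'n::finite" and F :: "'i \<Rightarrow> 'a^'n^'m"
  shows "(\<Sum>x\<in>S. F x) ** M = (\<Sum>x\<in>S. F x ** M)"
proof (induction S rule: infinite_finite_induct)
  case (insert x S)
  then show ?case
    by (simp add: matrix_matrix_mult_def vec_eq_iff distrib_right sum.distrib)
qed (auto simp: matrix_matrix_mult_def vec_eq_iff)

lemma mat_scale_nth [simp]: "mat_scale c M $ i $ j = c * M $ i $ j"
  by (simp add: mat_scale_def map_matrix_def)

lemma mat_ctranspose_nth [simp]: "mat_ctranspose M $ i $ j = cnj (M $ j $ i)"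
  by (simp add: mat_ctranspose_def)

lemma mat_scale_mult_left: "mat_scale c (M :: complex^'n::finite^'m) ** N = mat_scale c (M ** N)"
  by (simp add: vec_eq_iff matrix_matrix_mult_def sum_distrib_left mult_ac)

lemma mat_scale_mult_right: "(M :: complex^'n::finite^'m) ** mat_scale c N = mat_scale c (M ** N)"
  by (simp add: vec_eq_iff matrix_matrix_mult_def sum_distrib_left mult_ac)

lemma mat_scale_scale: "mat_scale a (mat_scale b M) = mat_scale (a * b) M"
  by (simp add: vec_eq_iff mult_ac)

lemma mat_ctranspose_mult:
  "mat_ctranspose ((M :: complex^'n::finite^'m) ** N) = mat_ctranspose N ** mat_ctranspose M"
  by (simp add: vec_eq_iff matrix_matrix_mult_def mult_ac)

lemma mat_ctranspose_ctranspose: "mat_ctranspose (mat_ctranspose M) = M"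
  by (simp add: vec_eq_iff)

text \<open>The product is a 1 x 1 matrix whose only entry is the Hermitian inner product of
  \<open>u i\<close> and \<open>u j\<close>.\<close>

lemma orthonormal_basis_mult:
  assumes "orthonormal_basis u"
  shows "mat_ctranspose (column_mat (u i)) ** column_mat (u j) = (if i = j then mat 1 else 0)"
  using assms
  by (auto simp: orthonormal_basis_def vec_eq_iff matrix_matrix_mult_def columnvector_def mat_def
      forall_1)

lemma orthonormal_basis_resolution:
  fixes u :: "'n::finite \<Rightarrow> complex^'n"
  assumes "orthonormal_basis u"
  shows "(\<Sum>j\<in>UNIV. column_mat (u j) ** mat_ctranspose (column_mat (u j))) = mat 1"
proof -
  \<comment> \<open>The columns of \<open>V\<close> are the basis vectors; they are indexed by the
    coordinate type itself, so \<open>V\<close> is square and its left inverse is also a right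
    inverse.\<close>
  define V :: "complex^'n^'n" where "V = (\<chi> i j. u j $ i)"
  have "mat_ctranspose V ** V = mat 1"
    using assms by (simp add: V_def orthonormal_basis_def vec_eq_iff matrix_matrix_mult_def mat_def)
  then have "V ** mat_ctranspose V = mat 1"
    by (simp add: matrix_left_right_inverse)
  \<comment> \<open>The inner index of this product runs over the basis vectors, so each
    \<open>j\<close> contributes one rank-one projection.\<close>
  moreover have "V ** mat_ctranspose V
      = (\<Sum>j\<in>UNIV. column_mat (u j) ** mat_ctranspose (column_mat (u j)))"
    by (simp add: V_def vec_eq_iff matrix_matrix_mult_def columnvector_def)
  ultimately show ?thesis by simp
qed

text \<open>Orthonormality kills every term of the spectral sum except the one with
  \<open>j = i\<close>. The left form is the useful one because powers of \<open>A\<close> stand to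
  the left of \<open>B\<close> in the action.\<close>

lemma spectral_left_eigenvector:
  fixes A :: "complex^'n^'n"
  assumes "orthonormal_basis u"
    and "A = (\<Sum>j\<in>UNIV. mat_scale (lam j) (column_mat (u j) ** mat_ctranspose (column_mat (u j))))"
  shows "mat_ctranspose (column_mat (u i)) ** A = mat_scale (lam i) (mat_ctranspose (column_mat (u i)))"
proof -
  have "mat_ctranspose (column_mat (u i)) ** A
      = (\<Sum>j\<in>UNIV. mat_scale (lam j) ((if i = j then mat 1 else 0) ** mat_ctranspose (column_mat (u j))))"
    by (simp add: assms(2) matrix_mult_sum_right mat_scale_mult_right matrix_mul_assoc
        orthonormal_basis_mult[OF assms(1)])
  also have "\<dots> = (\<Sum>j\<in>UNIV. if i = j then mat_scale (lam j) (mat_ctranspose (column_mat (u j))) else 0)"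
    by (intro sum.cong) (auto simp: vec_eq_iff)
  finally show ?thesis by simp
qed

text \<open>\<open>mat_power\<close> adds each new factor on the left, where \<open>H\<close> meets
  it first and turns it into a scalar \<open>c\<close>.\<close>

lemma left_eigenvector_power:
  fixes A :: "complex^'n::finite^'n"
  assumes "H ** A = mat_scale c H"
  shows "H ** mat_power A k = mat_scale (c ^ k) H"
proof (induction k)
  case 0
  then show ?case by (simp add: vec_eq_iff)
next
  case (Suc k)
  then show ?case
    by (simp add: matrix_mul_assoc assms mat_scale_mult_left mat_scale_scale)
qed

text \<open>Each \<open>A^k\<close> collapses to the scalar \<open>c ^ k\<close>, which commutes
  past \<open>B\<close> onto the coefficient; \<open>H ** B\<close> then factors out of the
  sum.\<close>

lemma left_eigenvector_matpoly_action:
  fixes A :: "complex^'n::finite^'n"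
  assumes "H ** A = mat_scale c H"
  shows "H ** matpoly_action P A B = H ** B ** matpoly_eval P c"
  by (simp add: matpoly_action_def matpoly_eval_def matrix_mult_sum_right matrix_mul_assoc
      left_eigenvector_power[OF assms] mat_scale_mult_left mat_scale_mult_right)

theorem theorem3p3:
  fixes A :: "complex^'n^'n" and B :: "complex^'s^'n"
    and u :: "'n \<Rightarrow> complex^'n" and lam :: "'n \<Rightarrow> complex"
  assumes "normal_matrix A"
    and "orthonormal_basis u"
    and "A = (\<Sum>j\<in>UNIV. mat_scale (lam j) (column_mat (u j) ** mat_ctranspose (column_mat (u j))))"
  shows "\<forall>P Q :: 's matpoly.
    matpoly_inner A B P Q =
      (\<Sum>j\<in>UNIV. mat_ctranspose (matpoly_eval P (lam j))
         ** (mat_ctranspose (mat_ctranspose (column_mat (u j)) ** B)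
              ** (mat_ctranspose (column_mat (u j)) ** B))
         ** matpoly_eval Q (lam j))"
proof (intro allI)
  fix P Q :: "'s matpoly"
  let ?U = "\<lambda>j. column_mat (u j)"
  let ?H = "\<lambda>j. mat_ctranspose (?U j)"
  let ?X = "matpoly_action P A B" and ?Y = "matpoly_action Q A B"
  have action: "?H j ** matpoly_action R A B = ?H j ** B ** matpoly_eval R (lam j)"
    for j and R :: "'s matpoly"
    by (intro left_eigenvector_matpoly_action spectral_left_eigenvector assms)
  have "matpoly_inner A B P Q = mat_ctranspose ?X ** (\<Sum>j\<in>UNIV. ?U j ** ?H j) ** ?Y"
    by (simp add: matpoly_inner_def orthonormal_basis_resolution[OF assms(2)])
  \<comment> \<open>Each left factor is regrouped by \<open>X* u = (u* X)*\<close>, so that both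
    factors have the form to which \<open>action\<close> applies.\<close>
  also have "\<dots> = (\<Sum>j\<in>UNIV. mat_ctranspose (?H j ** ?X) ** (?H j ** ?Y))"
    by (simp add: matrix_mult_sum_right matrix_mult_sum_left mat_ctranspose_mult
        mat_ctranspose_ctranspose matrix_mul_assoc)
  also have "\<dots> = (\<Sum>j\<in>UNIV. mat_ctranspose (matpoly_eval P (lam j))
         ** (mat_ctranspose (?H j ** B) ** (?H j ** B)) ** matpoly_eval Q (lam j))"
    \<comment> \<open>The instantiation splits off only the evaluation factor and keeps
      \<open>mat_ctranspose (?H j ** B)\<close> whole, as in the goal.\<close>
    by (simp add: action mat_ctranspose_mult[of "?H _ ** B"] matrix_mul_assoc)
  finally show "matpoly_inner A B P Q = \<dots>" .
qed

end
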